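(* Let $G$ be a graph with $\chi_P(G)=k$ and $|V(G)|=n$. For all integers $\ell$ and $m$ such that $m\ge n+k+2$ and $\ell\ge m(n+1)+k+3$, the path-chromatic number of $R_\ell(R_m(G))$ is strictly larger than $k$.
   Context: Graphs are finite and simple; $[m]=\{1,\dots,m\}$. A path-decomposition of a graph $G$ is a sequence $B_1,\dots,B_s$ of subsets of $V(G)$ (bags) such that $V(G)=\bigcup_t B_t$; for each $uv\in E(G)$ there is $t$ with $u,v\in B_t$; and for each $v\in V(G)$ the sets $B_t$ containing $v$ are consecutive in the sequence. The chromatic number of a path-decomposition is $\max_t \chi(G[B_t])$. The path-chromatic number $\chi_P(G)$ is the minimum chromatic number over all path-decompositions of $G$. For a graph $G$ and a positive integer $m$, $R_m(G)$ is the graph with vertex set $\{(i,v): i\in[m],\ v\in V(G)\cup\{v_0\}\}$, where $v_0\notin V(G)$ is a new element, in which two distinct vertices $(i,v)$ and $(i',v')$ are adjacent if and only if either $i=i'$ and exactly one of $v,v'$ equals $v_0$, or $i\ne i'$, $v,v'\in V(G)$ and $vv'\in E(G)$. (In $R_\ell(R_m(G))$ the construction is applied to the graph $R_m(G)$, with a new element not in $V(R_m(G))$.) *)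

theory Defs
  imports "Graph_Theory.Graph_Theory"
begin

text \<open>
  Finite simple graphs are rendered as symmetric loop-free finite digraphs (\<open>pair_graph\<close>),
  each edge being represented by its two opposite arcs. The null graph is allowed.
\<close>

definition proper_coloring :: "('a, 'b) pre_digraph \<Rightarrow> nat \<Rightarrow> ('a \<Rightarrow> nat) \<Rightarrow> bool" where
  "proper_coloring G k c \<longleftrightarrow>
     (\<forall>v \<in> verts G. c v < k) \<and> (\<forall>u v. u \<rightarrow>\<^bsub>G\<^esub> v \<longrightarrow> c u \<noteq> c v)"

definition chromatic_number :: "('a, 'b) pre_digraph \<Rightarrow> nat" where
  "chromatic_number G = (LEAST k. \<exists>c. proper_coloring G k c)"

text \<open>
  A path-decomposition has at least one bag, so that the maximum over the bags is over a nonempty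
  set also for the null graph. Bags may be empty and may be repeated.
\<close>

definition path_decomposition :: "'a pair_pre_digraph \<Rightarrow> 'a set list \<Rightarrow> bool" where
  "path_decomposition G Bs \<longleftrightarrow>
     Bs \<noteq> [] \<and>
     \<Union> (set Bs) = pverts G \<and>
     (\<forall>(u, v) \<in> parcs G. \<exists>B \<in> set Bs. u \<in> B \<and> v \<in> B) \<and>
     (\<forall>v \<in> pverts G. \<forall>i j t. i \<le> j \<and> j \<le> t \<and> t < length Bs \<and> v \<in> Bs ! i \<and> v \<in> Bs ! t
        \<longrightarrow> v \<in> Bs ! j)"

definition decomposition_chromatic_number :: "'a pair_pre_digraph \<Rightarrow> 'a set list \<Rightarrow> nat" where
  "decomposition_chromatic_number G Bs =
     Max ((\<lambda>B. chromatic_number (with_proj G \<restriction> B)) ` set Bs)"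

definition path_chromatic_number :: "'a pair_pre_digraph \<Rightarrow> nat" where
  "path_chromatic_number G =
     (LEAST k. \<exists>Bs. path_decomposition G Bs \<and> decomposition_chromatic_number G Bs = k)"

text \<open>The new element $v_0$ is \<open>None\<close>, and a vertex \<open>v\<close> of \<open>G\<close> appears as \<open>Some v\<close>.\<close>

definition R_graph :: "nat \<Rightarrow> 'a pair_pre_digraph \<Rightarrow> (nat \<times> 'a option) pair_pre_digraph" where
  "R_graph m G =
     (let V = {1..m} \<times> insert None (Some ` pverts G) in
      \<lparr> pverts = V,
        parcs = {((i, x), (j, y)) | i x j y. (i, x) \<in> V \<and> (j, y) \<in> V \<and>
          (i = j \<and> (x = None) \<noteq> (y = None) \<or>
           i \<noteq> j \<and> (\<exists>u v. x = Some u \<and> y = Some v \<and> (u, v) \<in> parcs G))} \<rparr>)"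

lemma pair_graph_R_graph:
  assumes "pair_graph G"
  shows "pair_graph (R_graph m G)"
proof -
  interpret pair_graph G by fact
  have fin: "finite (pverts (R_graph m G))"
    by (simp add: R_graph_def Let_def)
  have sub: "parcs (R_graph m G) \<subseteq> pverts (R_graph m G) \<times> pverts (R_graph m G)"
    by (auto simp: R_graph_def Let_def)
  show ?thesis
  proof
    show "finite (parcs (R_graph m G))"
      using sub fin by (meson finite_SigmaI finite_subset)
    show "symmetric (with_proj (R_graph m G))"
      unfolding symmetric_def with_proj_simps
      by (rule symI) (auto simp: R_graph_def Let_def dest: arcs_symmetric)
  qed (use sub fin in \<open>auto simp: R_graph_def Let_def\<close>)
qed

lemma path_decomposition_trivial:
  assumes "pair_graph G"
  shows "path_decomposition G [pverts G]"
proof -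
  interpret pair_graph G by fact
  show ?thesis
    by (auto simp: path_decomposition_def dest: in_arcsD1 in_arcsD2)
qed

lemma proper_coloring_exists:
  assumes "finite (verts G)" "loopfree_digraph G"
  shows "\<exists>c. proper_coloring G (card (verts G)) c"
proof -
  interpret loopfree_digraph G by fact
  obtain f where f: "bij_betw f (verts G) {0..<card (verts G)}"
    using ex_bij_betw_finite_nat[OF assms(1)] by blast
  have "proper_coloring G (card (verts G)) f"
    unfolding proper_coloring_def
  proof (intro conjI ballI allI impI)
    show "f v < card (verts G)" if "v \<in> verts G" for v
      using f that by (auto simp: bij_betw_def)
    show "f u \<noteq> f v" if "u \<rightarrow>\<^bsub>G\<^esub> v" for u v
    proof
      assume "f u = f v"
      moreover have "u \<in> verts G" "v \<in> verts G" using that by auto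
      ultimately have "u = v" using f by (auto simp: bij_betw_def dest: inj_onD)
      then show False using that adj_not_same by blast
    qed
  qed
  then show ?thesis by blast
qed

end

theory Submission
  imports Defs
begin

text \<open>
  A linear order of the vertices of a graph yields a path-decomposition with bags
  \<open>{z} \<union> S\<^sub>z\<close>, where \<open>S\<^sub>z\<close> consists of the vertices from \<open>z\<close> on that have a neighbour up to
  \<open>z\<close>. Write $H = R_m(G)$ and suppose that all bags of a path-decomposition of $R_\ell(H)$ are
  $k$-colourable; it assigns an interval to every vertex of $R_\ell(H)$.

  Order the vertices $x$ of $H$ by the least right endpoint $r_x$ of the intervals of the copies
  $(i,x)$. The interval of $(i,u)$ then contains $r_z$ for every \<open>u \<in> S\<^sub>z\<close> and every column $i$
  outside a small set. If \<open>S\<^sub>z\<close> were not $(k-1)$-colourable, there would be more than $2k$ such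
  columns. Either the interval of one of their apexes contains $r_z$, or more than $k$ apex intervals
  lie on the same side of $r_z$; in the latter case the bag at their endpoint
  nearest to $r_z$ contains the copies of \<open>S\<^sub>z\<close> in all these columns and the apex of one of them.
  Such a bag needs more than $k$ colours, because a colouring of more than $k$ columns and an apex
  with $k$ colours induces one of \<open>S\<^sub>z\<close> with $k-1$ colours.

  On the other hand, every linear order of $H$ has some \<open>S\<^sub>z\<close> that is not $(k-1)$-colourable:
  discarding for every vertex $v$ of $G$ the column of its first copy and ordering $G$ by the first
  remaining copies \<open>z\<close> of its vertices, some bag \<open>{v} \<union> S\<^sub>v\<close> of $G$ is not $(k-1)$-colourable, and
  all remaining copies of \<open>S\<^sub>v\<close> are in \<open>S\<^sub>z\<close>. If \<open>z\<close> itself is not in \<open>S\<^sub>z\<close>, then the apex of its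
  column is, and it makes up for the missing vertex.
\<close>

section \<open>Colourability of bags and the path-chromatic number\<close>

definition colorable :: "('a \<times> 'a) set \<Rightarrow> 'a set \<Rightarrow> nat \<Rightarrow> bool" where
  "colorable E B k \<longleftrightarrow>
     (\<exists>c. (\<forall>v\<in>B. c v < k) \<and> (\<forall>u\<in>B. \<forall>v\<in>B. (u, v) \<in> E \<longrightarrow> c u \<noteq> c v))"

text \<open>Colours can be renumbered, so any finite palette of at most \<open>k\<close> colours
  will do, for instance \<open>{..<k}\<close> with one colour deleted.\<close>

lemma colorableI:
  assumes "finite C" "card C \<le> k" "\<And>v. v \<in> B \<Longrightarrow> c v \<in> C"
    and "\<And>u v. u \<in> B \<Longrightarrow> v \<in> B \<Longrightarrow> (u, v) \<in> E \<Longrightarrow> c u \<noteq> c v"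
  shows "colorable E B k"
proof -
  obtain f where f: "bij_betw f C {0..<card C}"
    using ex_bij_betw_finite_nat[OF assms(1)] by blast
  have "(f \<circ> c) v < k" if "v \<in> B" for v
    using bij_betwE[OF f] assms(2,3) that by fastforce
  moreover have "(f \<circ> c) u \<noteq> (f \<circ> c) v" if "u \<in> B" "v \<in> B" "(u, v) \<in> E" for u v
    using f assms(3,4) that by (auto simp: bij_betw_def dest: inj_onD)
  ultimately show ?thesis unfolding colorable_def by blast
qed

lemma colorable_mono: "colorable E B k \<Longrightarrow> k \<le> k' \<Longrightarrow> colorable E B k'"
  unfolding colorable_def by (elim ex_forward) (auto dest: order_less_le_trans)

lemma proper_coloring_induce:
  "proper_coloring (with_proj G \<restriction> B) k c \<longleftrightarrow>
     (\<forall>v\<in>B. c v < k) \<and> (\<forall>u\<in>B. \<forall>v\<in>B. (u, v) \<in> parcs G \<longrightarrow> c u \<noteq> c v)"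
  by (auto simp: proper_coloring_def arcs_ends_def arc_to_ends_def)

lemma colorable_card:
  assumes "irrefl E" "finite B"
  shows "colorable E B (card B)"
  by (rule colorableI[where c = id]) (use assms in \<open>auto simp: irrefl_def\<close>)

lemma chromatic_number_le_iff:
  assumes "irrefl (parcs G)" "finite B"
  shows "chromatic_number (with_proj G \<restriction> B) \<le> k \<longleftrightarrow> colorable (parcs G) B k"
proof -
  have eq: "chromatic_number (with_proj G \<restriction> B) = (LEAST k. colorable (parcs G) B k)"
    by (simp add: chromatic_number_def proper_coloring_induce colorable_def)
  show ?thesis
    unfolding eq
    using LeastI[of "colorable (parcs G) B", OF colorable_card[OF assms]]
    by (blast intro: Least_le colorable_mono)
qed

lemma (in pair_graph) irrefl_parcs: "irrefl (parcs G)"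
  using no_loops' by (auto simp: irrefl_def)

lemma (in pair_graph) decomposition_chromatic_number_le_iff:
  assumes "path_decomposition G Bs"
  shows "decomposition_chromatic_number G Bs \<le> k \<longleftrightarrow> (\<forall>B\<in>set Bs. colorable (parcs G) B k)"
proof -
  have "finite B" if "B \<in> set Bs" for B
    using that assms finite_subset[of B "pverts G"] by (auto simp: path_decomposition_def)
  moreover have "Bs \<noteq> []" using assms by (simp add: path_decomposition_def)
  ultimately show ?thesis
    by (simp add: decomposition_chromatic_number_def chromatic_number_le_iff[OF irrefl_parcs])
qed

lemma (in pair_graph) path_chromatic_number_le_iff:
  "path_chromatic_number G \<le> k \<longleftrightarrow>
     (\<exists>Bs. path_decomposition G Bs \<and> (\<forall>B\<in>set Bs. colorable (parcs G) B k))"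
proof
  have "pair_graph G" ..
  then have "\<exists>k Bs. path_decomposition G Bs \<and> decomposition_chromatic_number G Bs = k"
    using path_decomposition_trivial by blast
  from LeastI_ex[OF this] obtain Bs where "path_decomposition G Bs"
    "decomposition_chromatic_number G Bs = path_chromatic_number G"
    unfolding path_chromatic_number_def by blast
  then show "\<exists>Bs. path_decomposition G Bs \<and> (\<forall>B\<in>set Bs. colorable (parcs G) B k)"
    if "path_chromatic_number G \<le> k"
    using that decomposition_chromatic_number_le_iff by metis
next
  assume "\<exists>Bs. path_decomposition G Bs \<and> (\<forall>B\<in>set Bs. colorable (parcs G) B k)"
  then obtain Bs where "path_decomposition G Bs" "decomposition_chromatic_number G Bs \<le> k"
    using decomposition_chromatic_number_le_iff by blast
  then show "path_chromatic_number G \<le> k"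
    unfolding path_chromatic_number_def by (metis (mono_tags, lifting) Least_le order_trans)
qed

section \<open>Path-decompositions from vertex rankings\<close>

text \<open>
  Ranking the vertices by \<open>p\<close> yields a path-decomposition whose bag at \<open>z\<close> is
  \<open>insert z (strong_part E V p z)\<close>; the vertex \<open>z\<close> is outside the strong part precisely
  when all of its neighbours are ranked after it.
\<close>

definition strong_part :: "('a \<times> 'a) set \<Rightarrow> 'a set \<Rightarrow> ('a \<Rightarrow> nat) \<Rightarrow> 'a \<Rightarrow> 'a set" where
  "strong_part E V p z = {u \<in> V. p z \<le> p u \<and> (\<exists>w\<in>V. p w \<le> p z \<and> (w, u) \<in> E)}"

lemma strong_part_subset: "strong_part E V p z \<subseteq> V"
  by (auto simp: strong_part_def)

text \<open>An edge lies in the bag of its earlier end. The bags containing a vertex run from that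
  of its first neighbour, or from its own if all neighbours come later, to its own.\<close>

lemma (in pair_graph) path_decomposition_ranking:
  assumes p: "inj_on p (pverts G)" and ne: "pverts G \<noteq> {}"
  obtains Bs where "path_decomposition G Bs"
    "set Bs = (\<lambda>z. insert z (strong_part (parcs G) (pverts G) p z)) ` pverts G"
proof -
  let ?bag = "\<lambda>z. insert z (strong_part (parcs G) (pverts G) p z)"
  define zs where "zs = map (inv_into (pverts G) p) (sorted_list_of_set (p ` pverts G))"
  have zs: "set zs = pverts G"
    using p by (force simp: zs_def)
  have "map p zs = sorted_list_of_set (p ` pverts G)"
    by (auto simp: zs_def f_inv_into_f intro: map_idI)
  then have "sorted (map p zs)" by simp
  then have mono: "p (zs ! i) \<le> p (zs ! j)" if "i \<le> j" "j < length zs" for i j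
    using that by (simp add: sorted_iff_nth_mono)
  have "path_decomposition G (map ?bag zs)"
    unfolding path_decomposition_def
  proof (intro conjI ballI allI impI)
    show "map ?bag zs \<noteq> []" using zs ne by auto
    show "\<Union> (set (map ?bag zs)) = pverts G"
      using zs strong_part_subset[of "parcs G" "pverts G" p] by auto
  next
    fix e assume e: "e \<in> parcs G"
    obtain u v where uv: "e = (u, v)" by force
    have V: "u \<in> pverts G" "v \<in> pverts G" "(v, u) \<in> parcs G"
      using e uv by (auto dest: arcs_symmetric in_arcsD1 in_arcsD2)
    have "u \<in> ?bag v \<and> v \<in> ?bag v \<or> u \<in> ?bag u \<and> v \<in> ?bag u"
      using V e uv by (cases "p v \<le> p u") (auto simp: strong_part_def)
    then show "case e of (u, v) \<Rightarrow> \<exists>B\<in>set (map ?bag zs). u \<in> B \<and> v \<in> B"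
      using V zs uv by auto
  next
    fix v i j t
    assume v: "v \<in> pverts G"
      and *: "i \<le> j \<and> j \<le> t \<and> t < length (map ?bag zs) \<and>
        v \<in> map ?bag zs ! i \<and> v \<in> map ?bag zs ! t"
    have le: "p (zs ! i) \<le> p (zs ! j)" "p (zs ! j) \<le> p (zs ! t)"
      using * mono by auto
    have j: "zs ! j \<in> pverts G" using * zs nth_mem[of j zs] by auto
    have jv: "p (zs ! j) \<le> p v"
      using * le by (auto simp: strong_part_def)
    show "v \<in> map ?bag zs ! j"
    \<comment> \<open>In its own bag \<open>v\<close> need not be strong, but then the rank of
      \<open>zs ! j\<close> is squeezed to \<open>p v\<close>, so both bags are the same.\<close>
    proof (cases "v = zs ! i")
      case True
      then have "p (zs ! j) = p v" using le jv by simp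
      then have "zs ! j = v" using p j v by (simp add: inj_on_eq_iff)
      then show ?thesis using * by auto
    next
      case False
      then have "v \<in> strong_part (parcs G) (pverts G) p (zs ! i)" using * by auto
      then have "v \<in> strong_part (parcs G) (pverts G) p (zs ! j)"
        using jv le by (auto simp: strong_part_def intro: order_trans)
      then show ?thesis using * by auto
    qed
  qed
  moreover have "set (map ?bag zs) = ?bag ` pverts G" using zs by simp
  ultimately show thesis using that by blast
qed

lemma (in pair_graph) ex_bag_not_colorable:
  assumes "\<not> path_chromatic_number G \<le> k" "inj_on p (pverts G)"
  obtains z where "z \<in> pverts G"
    "\<not> colorable (parcs G) (insert z (strong_part (parcs G) (pverts G) p z)) k"
proof -
  have "pverts G \<noteq> {}"
  proof
    assume "pverts G = {}"
    then have "path_decomposition G [{}]"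
      using path_decomposition_trivial[of G] pair_graph_axioms by simp
    moreover have "colorable (parcs G) {} k" by (simp add: colorable_def)
    ultimately show False using assms(1) path_chromatic_number_le_iff by fastforce
  qed
  from path_decomposition_ranking[OF assms(2) this] obtain Bs where Bs: "path_decomposition G Bs"
    "set Bs = (\<lambda>z. insert z (strong_part (parcs G) (pverts G) p z)) ` pverts G" .
  obtain B where "B \<in> set Bs" "\<not> colorable (parcs G) B k"
    using assms(1) Bs(1) path_chromatic_number_le_iff[of k] by metis
  then show thesis
    using that by (auto simp: Bs(2))
qed

section \<open>Columns of \<open>R_graph m G\<close> and their colourings\<close>

lemma pverts_R_graph: "pverts (R_graph m G) = {1..m} \<times> insert None (Some ` pverts G)"
  by (simp add: R_graph_def Let_def)

lemma Some_in_R_graph [simp]: "(i, Some v) \<in> pverts (R_graph m G) \<longleftrightarrow> i \<in> {1..m} \<and> v \<in> pverts G"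
  and None_in_R_graph [simp]: "(i, None) \<in> pverts (R_graph m G) \<longleftrightarrow> i \<in> {1..m}"
  by (auto simp: pverts_R_graph)

lemma (in pair_graph) R_graph_Some_Some [simp]:
  "((i, Some u), (j, Some v)) \<in> parcs (R_graph m G) \<longleftrightarrow>
     i \<in> {1..m} \<and> j \<in> {1..m} \<and> i \<noteq> j \<and> (u, v) \<in> parcs G"
  by (auto simp: R_graph_def Let_def dest: in_arcsD1 in_arcsD2)

lemma R_graph_None_Some [simp]:
  "((i, None), (j, Some v)) \<in> parcs (R_graph m G) \<longleftrightarrow> i \<in> {1..m} \<and> i = j \<and> v \<in> pverts G"
  by (auto simp: R_graph_def Let_def)

lemma R_graph_Some_None [simp]:
  "((i, Some v), (j, None)) \<in> parcs (R_graph m G) \<longleftrightarrow> i \<in> {1..m} \<and> i = j \<and> v \<in> pverts G"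
  by (auto simp: R_graph_def Let_def)

lemma card_pverts_R_graph:
  assumes "finite (pverts G)"
  shows "card (pverts (R_graph m G)) = m * (card (pverts G) + 1)"
  using assms by (simp add: pverts_R_graph card_cartesian_product card_image)

text \<open>With more columns than colours, some colour occurs twice among the copies of
  \<open>u\<close>. Copies in one column are never adjacent, so two occurrences are wanted: one of
  them avoids any prescribed column \<open>i\<close>.\<close>

lemma majority_coloring:
  fixes f :: "'i \<Rightarrow> 'a \<Rightarrow> nat"
  assumes "finite Q" "k < card Q" "\<And>i u. i \<in> Q \<Longrightarrow> u \<in> X \<Longrightarrow> f i u < k"
  obtains d where "\<And>u. u \<in> X \<Longrightarrow> d u < k" "\<And>u i. u \<in> X \<Longrightarrow> \<exists>j\<in>Q. j \<noteq> i \<and> f j u = d u"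
proof -
  have "\<exists>a<k. \<forall>i. \<exists>j\<in>Q. j \<noteq> i \<and> f j u = a" if "u \<in> X" for u
  proof -
    have "(\<lambda>i. f i u) ` Q \<subseteq> {..<k}" using assms(3) that by auto
    then have "card ((\<lambda>i. f i u) ` Q) < card Q"
      using card_mono[of "{..<k}" "(\<lambda>i. f i u) ` Q"] assms(2) by simp
    then have "\<not> inj_on (\<lambda>i. f i u) Q" by (rule pigeonhole)
    then obtain i j where "i \<in> Q" "j \<in> Q" "i \<noteq> j" "f i u = f j u" by (auto simp: inj_on_def)
    then show ?thesis using assms(3) that by metis
  qed
  then show thesis using that by metis
qed

text \<open>
  A vertex keeps a colour it receives in two columns, except that the colour of the apex of column
  \<open>i\<close>, which does not occur in that column, is replaced by the colour received in column \<open>i\<close>.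
\<close>

lemma (in pair_graph) colorable_of_column_bag:
  assumes B: "colorable (parcs (R_graph m G)) B k"
    and Q: "Q \<subseteq> {1..m}" "k < card Q" and i: "i \<in> Q" and X: "X \<subseteq> pverts G"
    and sub: "Q \<times> Some ` X \<subseteq> B" "(i, None) \<in> B"
  shows "colorable (parcs G) X (k - 1)"
proof -
  obtain c where c: "\<And>y. y \<in> B \<Longrightarrow> c y < k"
    "\<And>y z. y \<in> B \<Longrightarrow> z \<in> B \<Longrightarrow> (y, z) \<in> parcs (R_graph m G) \<Longrightarrow> c y \<noteq> c z"
    using B unfolding colorable_def by blast
  have QB: "(j, Some u) \<in> B" if "j \<in> Q" "u \<in> X" for j u using that sub by auto
  obtain d where d: "\<And>u. u \<in> X \<Longrightarrow> d u < k"
    "\<And>u i. u \<in> X \<Longrightarrow> \<exists>j\<in>Q. j \<noteq> i \<and> c (j, Some u) = d u"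
    using majority_coloring[OF finite_subset[OF Q(1)] Q(2), of X "\<lambda>i u. c (i, Some u)"] c(1) QB
    by (metis finite_atLeastAtMost)
  define a where "a = c (i, None)"
  have ia: "c (i, Some u) \<noteq> a" if "u \<in> X" for u
    using c(2)[OF sub(2) QB[OF i that]] that Q i X by (force simp: a_def)
  have cross: "c (j, Some u) \<noteq> d v" if "j \<in> Q" "u \<in> X" "v \<in> X" "(u, v) \<in> parcs G" for j u v
  proof -
    obtain j' where "j' \<in> Q" "j' \<noteq> j" "c (j', Some v) = d v" using d(2)[OF \<open>v \<in> X\<close>, of j] by blast
    then show ?thesis using c(2)[OF QB[of j u] QB[of j' v]] that Q(1) by (force simp: subset_iff)
  qed
  have dd: "d u \<noteq> d v" if "u \<in> X" "v \<in> X" "(u, v) \<in> parcs G" for u v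
    using d(2)[OF that(1)] cross that by metis
  let ?c = "\<lambda>u. if d u = a then c (i, Some u) else d u"
  show ?thesis
  proof (rule colorableI[where C = "{..<k} - {a}" and c = ?c])
    show "card ({..<k} - {a}) \<le> k - 1"
      using c(1)[OF sub(2)] by (simp add: a_def)
    show "?c v \<in> {..<k} - {a}" if "v \<in> X" for v
      using that c(1)[OF QB] i ia d(1) by auto
    \<comment> \<open>If both colours are replaced, then \<open>d u = a = d v\<close>, which
      \<open>dd\<close> excludes; if only one is, \<open>cross\<close> in column \<open>i\<close>
      applies.\<close>
    show "?c u \<noteq> ?c v" if "u \<in> X" "v \<in> X" "(u, v) \<in> parcs G" for u v
      using that dd[OF that] cross[of i u v] cross[of i v u] i arcs_symmetric[of u v] by (auto)
  qed simp
qed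

section \<open>Rankings of \<open>R_graph m G\<close> have a strong part needing many
  colours\<close>

lemma (in pair_graph) ex_strong_part_not_colorable:
  assumes k: "\<not> path_chromatic_number G \<le> k"
    and m: "card (pverts G) + k < m"
    and p: "inj_on p (pverts (R_graph m G))"
  obtains z where "z \<in> pverts (R_graph m G)"
    "\<not> colorable (parcs (R_graph m G))
        (strong_part (parcs (R_graph m G)) (pverts (R_graph m G)) p z) k"
proof -
  let ?H = "R_graph m G"
  let ?X = "strong_part (parcs ?H) (pverts ?H) p"
  define e where "e v = arg_min_on (\<lambda>i. p (i, Some v)) {1..m}" for v
  have m1: "{1..m} \<noteq> {}" using m by simp
  have e: "e v \<in> {1..m}" "\<And>i. i \<in> {1..m} \<Longrightarrow> p (e v, Some v) \<le> p (i, Some v)" for v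
    unfolding e_def using arg_min_if_finite(1)[OF _ m1]
      arg_min_least[OF _ m1, where f = "\<lambda>i. p (i, Some v)"] by auto
  define S where "S = {1..m} - e ` pverts G"
  have cS: "k < card S"
    using m card_image_le[of "pverts G" e] diff_card_le_card_Diff[of "e ` pverts G" "{1..m}"]
    unfolding S_def by simp
  have S: "S \<subseteq> {1..m}" "S \<noteq> {}" "finite S"
    using cS by (fastforce simp: S_def, force, simp add: S_def)
  define j where "j v = arg_min_on (\<lambda>i. p (i, Some v)) S" for v
  have j: "j v \<in> S" "\<And>i. i \<in> S \<Longrightarrow> p (j v, Some v) \<le> p (i, Some v)" for v
    unfolding j_def using arg_min_if_finite(1)[OF S(3,2)] arg_min_least[OF S(3,2)] by auto
  define q where "q v = p (j v, Some v)" for v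
  have "inj_on q (pverts G)"
  proof (rule inj_onI)
    fix u v assume uv: "u \<in> pverts G" "v \<in> pverts G" "q u = q v"
    have "j u \<in> {1..m}" "j v \<in> {1..m}" using j(1) S(1) by blast+
    then have "(j u, Some u) = (j v, Some v)"
      using uv by (intro inj_onD[OF p]) (simp_all add: q_def)
    then show "u = v" by simp
  qed
  from ex_bag_not_colorable[OF k this] obtain v where v: "v \<in> pverts G"
    and nc: "\<not> colorable (parcs G) (insert v (strong_part (parcs G) (pverts G) q v)) k" .
  let ?Y = "strong_part (parcs G) (pverts G) q v"
  define z where "z = (j v, Some v)"
  have jm: "j v \<in> {1..m}" using j(1) S(1) by blast
  have zV: "z \<in> pverts ?H" using jm v by (simp add: z_def)
  have pz: "p z = q v" by (simp add: z_def q_def)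
  have YV: "?Y \<subseteq> pverts G" by (rule strong_part_subset)
  \<comment> \<open>The first copy of \<open>w\<close> lies in a discarded column, hence is adjacent
    to \<open>(i, Some u)\<close>. It is ranked no later than \<open>(j w, Some w)\<close>, so no
    later than \<open>z\<close>.\<close>
  have SY: "(i, Some u) \<in> ?X z" if i: "i \<in> S" and u: "u \<in> ?Y" for i u
  proof -
    obtain w where w: "w \<in> pverts G" "q w \<le> q v" "(w, u) \<in> parcs G"
      using u by (auto simp: strong_part_def)
    have "p (e w, Some w) \<le> p z"
      using e(2)[of "j w" w] j(1)[of w] S(1) w(2) by (auto simp: pz q_def)
    moreover have "e w \<noteq> i" using i w by (auto simp: S_def)
    moreover have "p z \<le> p (i, Some u)"
      using u j(2)[OF i, of u] by (auto simp: strong_part_def pz q_def)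
    ultimately show ?thesis
      using w i S(1) u e(1)[of w]
      by (auto simp: strong_part_def intro!: bexI[of _ "(e w, Some w)"])
  qed
  have "\<not> colorable (parcs ?H) (?X z) k"
  proof
    assume col: "colorable (parcs ?H) (?X z) k"
    show False
    \<comment> \<open>If \<open>z\<close> is not strong, its neighbour \<open>(j v, None)\<close> is ranked later, hence strong.\<close>
    proof (cases "z \<in> ?X z")
      case True
      obtain c where c: "\<And>y. y \<in> ?X z \<Longrightarrow> c y < k"
        "\<And>x y. x \<in> ?X z \<Longrightarrow> y \<in> ?X z \<Longrightarrow> (x, y) \<in> parcs ?H \<Longrightarrow> c x \<noteq> c y"
        using col unfolding colorable_def by blast
      obtain d where d: "\<And>u. u \<in> ?Y \<Longrightarrow> d u < k"
        "\<And>u i. u \<in> ?Y \<Longrightarrow> \<exists>j\<in>S. j \<noteq> i \<and> c (j, Some u) = d u"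
        using majority_coloring[OF S(3) cS, of ?Y "\<lambda>i u. c (i, Some u)"] c(1) SY by metis
      \<comment> \<open>Not restricted to copies of \<open>?Y\<close>, so that it also covers
        \<open>z\<close>, whose vertex \<open>v\<close> need not be in \<open>?Y\<close>.\<close>
      have cross: "c (i, Some u) \<noteq> d w"
        if "(i, Some u) \<in> ?X z" "w \<in> ?Y" "(u, w) \<in> parcs G" for i u w
      proof -
        obtain i' where "i' \<in> S" "i' \<noteq> i" "c (i', Some w) = d w" using d(2) \<open>w \<in> ?Y\<close> by blast
        then show ?thesis
          using c(2)[OF that(1) SY[of i' w]] that S(1) subsetD[OF strong_part_subset that(1)] by auto
      qed
      have vd: "c z \<noteq> d u" if "u \<in> ?Y" "(v, u) \<in> parcs G" for u
        using cross[of "j v" v u] True that by (simp add: z_def)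
      have dd: "d u \<noteq> d w" if "u \<in> ?Y" "w \<in> ?Y" "(u, w) \<in> parcs G" for u w
        using d(2)[OF that(1)] cross[OF SY] that by metis
      have "colorable (parcs G) (insert v ?Y) k"
      proof (rule colorableI[where C = "{..<k}" and c = "\<lambda>u. if u = v then c z else d u"])
        show "(if u = v then c z else d u) \<in> {..<k}" if "u \<in> insert v ?Y" for u
          using that c(1)[OF True] d(1) by auto
        show "(if u = v then c z else d u) \<noteq> (if w = v then c z else d w)"
          if "u \<in> insert v ?Y" "w \<in> insert v ?Y" "(u, w) \<in> parcs G" for u w
          using that dd[of u w] vd[of u] vd[of w] arcs_symmetric[of u w] no_loops'[of v v]
          by auto
      qed auto
      then show False using nc by simp
    next
      case False
      have "\<not> p (j v, None) \<le> p z"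
      proof
        assume "p (j v, None) \<le> p z"
        then have "z \<in> ?X z"
          using zV jm v by (auto simp: strong_part_def z_def intro!: bexI[of _ "(j v, None)"])
        then show False using False by simp
      qed
      then have apex: "(j v, None) \<in> ?X z"
        using zV jm v by (auto simp: strong_part_def z_def intro!: bexI[of _ "(j v, Some v)"])
      \<comment> \<open>The apex costs the copies of \<open>?Y\<close> one colour, which leaves
        \<open>k - 1\<close> as a fresh colour for \<open>v\<close>.\<close>
      have "colorable (parcs G) ?Y (k - 1)"
        using colorable_of_column_bag[OF col S(1) cS j(1) YV _ apex] SY by blast
      then obtain c where c: "\<And>u. u \<in> ?Y \<Longrightarrow> c u < k - 1"
        "\<And>u w. u \<in> ?Y \<Longrightarrow> w \<in> ?Y \<Longrightarrow> (u, w) \<in> parcs G \<Longrightarrow> c u \<noteq> c w"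
        unfolding colorable_def by blast
      have "0 < k" using apex col unfolding colorable_def by fastforce
      have cv: "c u < k" "c u \<noteq> k - 1" if "u \<in> ?Y" for u
        using c(1)[OF that] by auto
      have "colorable (parcs G) (insert v ?Y) k"
      proof (rule colorableI[where C = "{..<k}" and c = "\<lambda>u. if u = v then k - 1 else c u"])
        show "(if u = v then k - 1 else c u) \<in> {..<k}" if "u \<in> insert v ?Y" for u
          using that cv(1) \<open>0 < k\<close> by auto
        show "(if u = v then k - 1 else c u) \<noteq> (if w = v then k - 1 else c w)"
          if "u \<in> insert v ?Y" "w \<in> insert v ?Y" "(u, w) \<in> parcs G" for u w
          using that c(2)[of u w] cv(2)[of u] cv(2)[of w] no_loops'[of v v] by auto
      qed auto
      then show False using nc by simp
    qed
  qed
  then show thesis using that zV by blast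
qed

section \<open>Intervals of a path-decomposition\<close>

lemma (in pair_graph) path_decomposition_intervals:
  assumes "path_decomposition G Bs"
  obtains L R :: "'a \<Rightarrow> nat" where
    "\<And>v. v \<in> pverts G \<Longrightarrow> L v \<le> R v"
    "\<And>u v. (u, v) \<in> parcs G \<Longrightarrow> L u \<le> R v"
    "\<And>t v. v \<in> pverts G \<Longrightarrow> L v \<le> t \<Longrightarrow> t \<le> R v \<Longrightarrow> t < length Bs \<and> v \<in> Bs ! t"
proof -
  define T where "T v = {t. t < length Bs \<and> v \<in> Bs ! t}" for v
  have fin: "finite (T v)" for v by (simp add: T_def)
  have ne: "T v \<noteq> {}" if v: "v \<in> pverts G" for v
  proof -
    obtain B where "B \<in> set Bs" "v \<in> B"
      using assms v unfolding path_decomposition_def by blast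
    then show ?thesis by (auto simp: T_def in_set_conv_nth)
  qed
  show thesis
  proof (rule that[of "\<lambda>v. Min (T v)" "\<lambda>v. Max (T v)"])
    show "Min (T v) \<le> Max (T v)" if "v \<in> pverts G" for v
      using fin ne[OF that] by (meson Max_ge Min_in)
    show "Min (T u) \<le> Max (T v)" if uv: "(u, v) \<in> parcs G" for u v
    proof -
      obtain B where "B \<in> set Bs" "u \<in> B" "v \<in> B"
        using assms uv unfolding path_decomposition_def by blast
      then obtain t where t: "t \<in> T u" "t \<in> T v" by (auto simp: T_def in_set_conv_nth)
      show ?thesis using Min_le[OF fin t(1)] Max_ge[OF fin t(2)] by simp
    qed
    show "t < length Bs \<and> v \<in> Bs ! t"
      if v: "v \<in> pverts G" and t: "Min (T v) \<le> t" "t \<le> Max (T v)" for t v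
    proof -
      have "v \<in> Bs ! Min (T v)" "Max (T v) < length Bs" "v \<in> Bs ! Max (T v)"
        using Min_in[OF fin ne[OF v]] Max_in[OF fin ne[OF v]] by (simp_all add: T_def)
      moreover from this have "v \<in> Bs ! t"
        using assms v t unfolding path_decomposition_def by blast
      ultimately show ?thesis using t by simp
    qed
  qed
qed

text \<open>Ties of \<open>r\<close> are broken by an enumeration \<open>f\<close>: the
  lexicographic order is coded by numbers with last digit \<open>f x\<close> in base
  \<open>card V\<close>.\<close>

lemma ex_sorted_ranking:
  fixes r :: "'a \<Rightarrow> nat"
  assumes "finite V"
  obtains p :: "'a \<Rightarrow> nat" where "inj_on p V" "\<And>x y. x \<in> V \<Longrightarrow> y \<in> V \<Longrightarrow> p x \<le> p y \<Longrightarrow> r x \<le> r y"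
proof -
  obtain f :: "'a \<Rightarrow> nat" where f: "bij_betw f V {0..<card V}"
    using ex_bij_betw_finite_nat[OF assms] by blast
  define p where "p x = r x * card V + f x" for x
  have fl: "f x < card V" if "x \<in> V" for x using bij_betwE[OF f] that by auto
  have dm: "p x div card V = r x" "p x mod card V = f x" if "x \<in> V" for x
    using fl[OF that] by (auto simp: p_def)
  show thesis
  proof (rule that[of p])
    show "inj_on p V"
      using f dm by (metis bij_betw_def inj_on_def)
    show "r x \<le> r y" if "x \<in> V" "y \<in> V" "p x \<le> p y" for x y
      using that dm(1) div_le_mono by metis
  qed
qed

section \<open>A ranking whose strong parts need few colours\<close>

lemma (in pair_graph) strong_part_colorable:
  assumes k: "path_chromatic_number (R_graph l G) \<le> k"
    and l: "card (pverts G) + k + 1 < l"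
  obtains p :: "'a \<Rightarrow> nat" where "inj_on p (pverts G)"
    "\<And>z. z \<in> pverts G \<Longrightarrow> colorable (parcs G) (strong_part (parcs G) (pverts G) p z) (k - 1)"
proof -
  have "pair_graph G" ..
  then interpret R: pair_graph "R_graph l G" by (rule pair_graph_R_graph)
  obtain Bs where Bs: "path_decomposition (R_graph l G) Bs"
    and col: "\<And>B. B \<in> set Bs \<Longrightarrow> colorable (parcs (R_graph l G)) B k"
    using k R.path_chromatic_number_le_iff by blast
  obtain L R where LR: "\<And>y. y \<in> pverts (R_graph l G) \<Longrightarrow> L y \<le> R y"
    "\<And>x y. (x, y) \<in> parcs (R_graph l G) \<Longrightarrow> L x \<le> R y"
    "\<And>t y. y \<in> pverts (R_graph l G) \<Longrightarrow> L y \<le> t \<Longrightarrow> t \<le> R y \<Longrightarrow> t < length Bs \<and> y \<in> Bs ! t"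
    using R.path_decomposition_intervals[OF Bs] by metis
  define e where "e v = arg_min_on (\<lambda>i. R (i, Some v)) {1..l}" for v
  have l1: "{1..l} \<noteq> {}" using l by simp
  have e: "e v \<in> {1..l}" "\<And>i. i \<in> {1..l} \<Longrightarrow> R (e v, Some v) \<le> R (i, Some v)" for v
    unfolding e_def using arg_min_if_finite(1)[OF _ l1]
      arg_min_least[OF _ l1, where f = "\<lambda>i. R (i, Some v)"] by auto
  define r where "r v = R (e v, Some v)" for v
  obtain p :: "'a \<Rightarrow> nat" where p: "inj_on p (pverts G)"
    and pr: "\<And>x y. x \<in> pverts G \<Longrightarrow> y \<in> pverts G \<Longrightarrow> p x \<le> p y \<Longrightarrow> r x \<le> r y"
    using ex_sorted_ranking[of "pverts G" r] by auto
  have "colorable (parcs G) (strong_part (parcs G) (pverts G) p z) (k - 1)" if z: "z \<in> pverts G" for z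
  proof (rule ccontr)
    let ?X = "strong_part (parcs G) (pverts G) p z"
    assume nc: "\<not> colorable (parcs G) ?X (k - 1)"
    have XV: "?X \<subseteq> pverts G" by (rule strong_part_subset)
    have fX: "finite ?X" using XV by (rule finite_subset) simp
    have "k \<le> card ?X"
      using nc colorable_mono[OF colorable_card[OF irrefl_parcs fX], of "k - 1"] by linarith
    define W where "W = {w \<in> pverts G. p w \<le> p z}"
    define F where "F = {1..l} - e ` W"
    have fW: "finite W" by (simp add: W_def)
    \<comment> \<open>The vertices up to \<open>z\<close> and the strong ones from \<open>z\<close>
      on share at most \<open>z\<close>, so a large \<open>?X\<close> forces a small
      \<open>W\<close>. At least \<open>card ?X + k + 1\<close> columns remain, hence more than
      \<open>2 * k\<close>, enough for one side of \<open>r z\<close> to get more than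
      \<open>k\<close>.\<close>
    have "?X \<inter> W \<subseteq> {z}" using p z by (auto simp: strong_part_def W_def dest: inj_onD)
    then have "card (?X \<inter> W) \<le> 1" using card_mono[of "{z}"] by simp
    moreover have "card (?X \<union> W) \<le> card (pverts G)"
      by (rule card_mono) (use XV in \<open>auto simp: W_def\<close>)
    ultimately have "card ?X + card W \<le> card (pverts G) + 1"
      using card_Un_Int[OF fX fW] by linarith
    moreover have "l - card W \<le> card F"
      using diff_card_le_card_Diff[of "e ` W" "{1..l}"] card_image_le[OF fW, of e] fW
      unfolding F_def by simp
    ultimately have cF: "2 * k < card F" using \<open>k \<le> card ?X\<close> l by linarith
    have F_le: "F \<subseteq> {1..l}" by (auto simp: F_def)
    have fF: "finite F" using F_le by (rule finite_subset) simp
    \<comment> \<open>The copy of \<open>w\<close> ending at \<open>r w\<close> lies outside the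
      columns \<open>F\<close>, so it is adjacent to \<open>(i, Some u)\<close>; this bounds
      \<open>L\<close>. Minimality of \<open>r u\<close> over all columns bounds
      \<open>R\<close>.\<close>
    have FX: "L (i, Some u) \<le> r z" "r z \<le> R (i, Some u)"
      if iF: "i \<in> F" and uX: "u \<in> ?X" for i u
    proof -
      obtain w where w: "w \<in> pverts G" "p w \<le> p z" "(w, u) \<in> parcs G"
        using uX by (auto simp: strong_part_def)
      have "e w \<noteq> i" using that w by (auto simp: F_def W_def)
      then have "L (i, Some u) \<le> r w"
        unfolding r_def using LR(2) e(1) w F_le iF uX XV arcs_symmetric by auto
      then show "L (i, Some u) \<le> r z" using pr[OF w(1) z w(2)] by simp
      have "r z \<le> r u" using uX pr z by (auto simp: strong_part_def)
      also have "\<dots> \<le> R (i, Some u)" using e(2) iF F_le by (auto simp: r_def)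
      finally show "r z \<le> R (i, Some u)" .
    qed
    have no: False
      if Q: "Q \<subseteq> F" "k < card Q" and i: "i \<in> Q" "L (i, None) \<le> t" "t \<le> R (i, None)"
        and QX: "\<And>i u. i \<in> Q \<Longrightarrow> u \<in> ?X \<Longrightarrow> L (i, Some u) \<le> t \<and> t \<le> R (i, Some u)" for Q i t
    proof -
      have il: "i \<in> {1..l}" using i Q F_le by blast
      have t: "t < length Bs" "(i, None) \<in> Bs ! t" using LR(3)[of "(i, None)" t] i il by auto
      have "Q \<times> Some ` ?X \<subseteq> Bs ! t"
        using LR(3) QX Q F_le XV by (auto simp: subset_iff)
      then show False
        using colorable_of_column_bag[OF col[OF nth_mem[OF t(1)]] _ Q(2) i(1) XV _ t(2)] Q F_le nc by auto
    qed
    have apex: "L (i, None) \<le> R (i, Some u)" "L (i, Some u) \<le> R (i, None)"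
      if "i \<in> F" "u \<in> ?X" for i u
    proof -
      have "i \<in> {1..l}" "u \<in> pverts G" using that F_le XV by auto
      then show "L (i, None) \<le> R (i, Some u)" "L (i, Some u) \<le> R (i, None)"
        by (simp_all add: LR(2))
    qed
    define Fl where "Fl = {i \<in> F. R (i, None) < r z}"
    define Fr where "Fr = {i \<in> F. r z < L (i, None)}"
    have "F = Fl \<union> Fr"
    proof (rule ccontr)
      assume "F \<noteq> Fl \<union> Fr"
      then have "\<exists>i\<in>F. \<not> R (i, None) < r z \<and> \<not> r z < L (i, None)"
        by (auto simp: Fl_def Fr_def)
      then obtain i where "i \<in> F" "L (i, None) \<le> r z" "r z \<le> R (i, None)"
        by (auto simp: not_less)
      then show False using no[of F i "r z"] FX cF by auto
    qed
    then have "card F \<le> card Fl + card Fr" using card_Un_le by simp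
    then have "k < card Fl \<or> k < card Fr" using cF by linarith
    then show False
    proof
      assume c: "k < card Fl"
      have f: "finite Fl" "Fl \<noteq> {}" using c by (auto intro: card_ge_0_finite)
      \<comment> \<open>Each interval of a copy of \<open>?X\<close> in these columns meets that of
        its apex, so it begins by \<open>t\<close>, and it reaches \<open>r z\<close>, which is
        beyond \<open>t\<close>.\<close>
      define t where "t = Max ((\<lambda>i. R (i, None)) ` Fl)"
      have "t \<in> (\<lambda>i. R (i, None)) ` Fl" unfolding t_def by (rule Max_in) (use f in auto)
      then obtain i where i: "i \<in> Fl" "R (i, None) = t" by auto
      have ge: "R (i, None) \<le> t" if "i \<in> Fl" for i unfolding t_def by (rule Max_ge) (use f that in auto)
      show False
      proof (rule no[OF _ c i(1)])
        show "Fl \<subseteq> F" by (auto simp: Fl_def)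
        show "L (i, None) \<le> t" using i LR(1)[of "(i, None)"] F_le by (auto simp: Fl_def)
        show "t \<le> R (i, None)" using i by simp
        show "L (j, Some u) \<le> t \<and> t \<le> R (j, Some u)" if "j \<in> Fl" "u \<in> ?X" for j u
          using that ge[of j] apex(2)[of j u] FX(2)[of j u] i by (auto simp: Fl_def)
      qed
    next
      assume c: "k < card Fr"
      have f: "finite Fr" "Fr \<noteq> {}" using c by (auto intro: card_ge_0_finite)
      \<comment> \<open>Mirror image: the endpoint nearest to \<open>r z\<close> is now the least
        left endpoint.\<close>
      define t where "t = Min ((\<lambda>i. L (i, None)) ` Fr)"
      have "t \<in> (\<lambda>i. L (i, None)) ` Fr" unfolding t_def by (rule Min_in) (use f in auto)
      then obtain i where i: "i \<in> Fr" "L (i, None) = t" by auto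
      have le: "t \<le> L (i, None)" if "i \<in> Fr" for i unfolding t_def by (rule Min_le) (use f that in auto)
      show False
      proof (rule no[OF _ c i(1)])
        show "Fr \<subseteq> F" by (auto simp: Fr_def)
        show "t \<le> R (i, None)" using i LR(1)[of "(i, None)"] F_le by (auto simp: Fr_def)
        show "L (i, None) \<le> t" using i by simp
        show "L (j, Some u) \<le> t \<and> t \<le> R (j, Some u)" if "j \<in> Fr" "u \<in> ?X" for j u
          using that le[of j] apex(1)[of j u] FX(1)[of j u] i by (auto simp: Fr_def)
      qed
    qed
  qed
  then show thesis using that p by blast
qed

section \<open>Positivity and the final contradiction\<close>

lemma (in pair_graph) path_chromatic_number_pos:
  assumes "pverts G \<noteq> {}"
  shows "path_chromatic_number G > 0"
proof (rule ccontr)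
  assume "\<not> path_chromatic_number G > 0"
  then obtain Bs where Bs: "path_decomposition G Bs"
    and "\<And>B. B \<in> set Bs \<Longrightarrow> colorable (parcs G) B 0"
    using path_chromatic_number_le_iff[of 0] by auto
  then have "B = {}" if "B \<in> set Bs" for B using that by (auto simp: colorable_def)
  moreover have "\<Union> (set Bs) = pverts G" using Bs unfolding path_decomposition_def by blast
  ultimately show False using assms by blast
qed

theorem theorem1p3:
  fixes G :: "'a pair_pre_digraph" and k n l m :: nat
  assumes "pair_graph G"
    and "path_chromatic_number G = k"
    and "card (pverts G) = n"
    and "m \<ge> n + k + 2"
    and "l \<ge> m * (n + 1) + k + 3"
  shows "path_chromatic_number (R_graph l (R_graph m G)) > k"
proof -
  interpret pair_graph G by fact
  interpret H: pair_graph "R_graph m G" by (rule pair_graph_R_graph) fact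
  interpret RH: pair_graph "R_graph l (R_graph m G)" by (rule pair_graph_R_graph) unfold_locales
  show ?thesis
  \<comment> \<open>For \<open>k = 0\<close> the truncated \<open>k - 1\<close> is not below
    \<open>k\<close>, so the main argument fails; a nonempty graph suffices there.\<close>
  proof (cases "k = 0")
    case True
    have "(1, None) \<in> pverts (R_graph l (R_graph m G))" using assms by simp
    then show ?thesis using True RH.path_chromatic_number_pos by blast
  next
    case False
    show ?thesis
    proof (rule ccontr)
      assume "\<not> ?thesis"
      then have le: "path_chromatic_number (R_graph l (R_graph m G)) \<le> k" by simp
      have "card (pverts (R_graph m G)) + k + 1 < l"
        using assms by (simp add: card_pverts_R_graph)
      from H.strong_part_colorable[OF le this] obtain p where p: "inj_on p (pverts (R_graph m G))"
        "\<And>z. z \<in> pverts (R_graph m G) \<Longrightarrow> colorable (parcs (R_graph m G))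
          (strong_part (parcs (R_graph m G)) (pverts (R_graph m G)) p z) (k - 1)"
        by blast
      have "\<not> path_chromatic_number G \<le> k - 1" using False assms by simp
      moreover have "card (pverts G) + (k - 1) < m" using assms by simp
      ultimately show False using ex_strong_part_not_colorable[OF _ _ p(1)] p(2) by blast
    qed
  qed
qed

end
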